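(* Let $[x_0,y_0]$ be a given interval greater than unit and let $\lambda>1$ be a fixed real number. There is a unique way of assigning to each interval $[a,b]$ a real number $|[a,b]|$ such that: (1) $|[a,b]|$ is a positive real number and $|[x_0,y_0]|=\lambda$; (2) $|[a,b]|<1$ iff $b*a$, $|[a,b]|=1$ iff $a\sim b$, and $|[a,b]|>1$ iff $a*b$; (3) $|[a,b]|=|[c,d]|$ if and only if $[a,b]\cong[c,d]$; (4) $|[a,b]|<|[c,d]|$ if and only if $\overline{[a,b]}\prec\overline{[c,d]}$; (5) for any $a,b,c\in\mathbb{S}$, $|[a,c]|=|[a,b]|\cdot|[b,c]|$; (6) for any dyadic number $w$, $|w\cdot[a,b]|=|[a,b]|^w$; (7) for any positive real number $r$, there exists an interval $[a,b]$, unique up to congruence, such that $|[a,b]|=r$.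
   Context: Setting: a set $\mathbb{S}$ (of "sounds"), a binary relation $*$ on $\mathbb{S}$ ($x*y$: $x$ is lower-pitched than $y$) and a relation $\cong$ on intervals, satisfying the axioms below. Pitch. Write $x\sim y$ iff neither $x*y$ nor $y*x$. (1) $\neg(x*x)$ for all $x$. (2) $*$ is transitive. (3) There are $x,y$ with $x*y$ or $y*x$. (4) If $x*y$, then no $z$ satisfies both $x\sim z$ and $y\sim z$. (5) For every $x$ there are $a,b$ with $a*x$ and $x*b$; and if $x*y$ there is $a$ with $x*a$ and $a*y$. Then $\sim$ is an equivalence relation; $\tilde x$ is the class of $x$. Intervals. $[a,b]:=(\tilde a,\tilde b)$, $[a,b]^{-1}:=[b,a]$, $\mathbb{I}:=(\mathbb{S}/\sim)\times(\mathbb{S}/\sim)$, and $\cong$ is a binary relation on $\mathbb{I}$. (6) $\cong$ is reflexive. (7) $\cong$ is transitive. (8) For all $x,y,a$ there is $b$ with $[x,y]\cong[a,b]$, and any $b'$ with $[x,y]\cong[a,b']$ satisfies $b\sim b'$. (9) If $a*b$: $[a,b]\cong[c,d]$ implies $c*d$; and $[a,b]\cong[c,d]$ iff $[b,a]\cong[d,c]$. (10) If $a*b$ and $b*c$: $[a,b]\cong[a',b']$ and $[b,c]\cong[b',c']$ imply $[a,c]\cong[a',c']$; and $[a,b]\cong[a',b']^{-1}$ and $[b,c]\cong[b',c']^{-1}$ imply $[a,c]\cong[a',c']^{-1}$. (11) (Dedekind) If $\mathbb{S}$ is partitioned into two nonempty sets $P,Q$ such that no sound of $Q$ is lower-pitched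 than a sound of $P$, there is $\theta\in\mathbb{S}$ such that every $s*\theta$ lies in $P$ and every $s$ with $\theta*s$ lies in $Q$. Then $\cong$ is an equivalence relation. $[a,b]$ is unit if $a\sim b$, greater than unit if $a*b$, less than unit if $b*a$. For $[a,b],[c,d]$ greater than unit, $[a,b]<[c,d]$ iff there is $x*d$ with $[a,b]\cong[c,x]$. For $[a,b],[c,d]$ less than unit, $[a,b]<[c,d]$ iff $[d,c]<[b,a]$. The $\cong$-class $\overline{[a,b]}$ is called a free interval; $\overline{[a,b]}\prec\overline{[c,d]}$ iff one of: $[c,d]$ is greater than unit and $[a,b]$ is less than unit, or unit, or satisfies $[a,b]<[c,d]$; or $[c,d]$ is unit and $[a,b]$ is less than unit; or both are less than unit and $[a,b]<[c,d]$. Dyadic numbers: $\mathbb{D}=\{n/2^k:n\in\mathbb{Z},k\in\mathbb{N}\}$. Products: $1\cdot[a,b]=[a,b]$; if $n\cdot[a,b]=[a,b_n]$ then $(n+1)\cdot[a,b]=[a,b_{n+1}]$ where $[b_n,b_{n+1}]\cong[a,b]$; $0\cdot[a,b]=[a,a]$; $n\cdot[a,b]=(-n)\cdot[a,b]^{-1}$ for negative integers $n$; $\frac12\cdot[a,b]=[a,m]$ where $m$ is a midsound, i.e. $[a,m]\cong[m,b]$ (it exists and is unique up to $\sim$); $\frac1{2^{k+1}}\cdot[a,b]=\frac12\cdot(\frac1{2^k}\cdot[a,b])$; $\frac n{2^k}\cdot[a,b]=n\cdot(\frac1{2^k}\cdot[a,b])$. *)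

theory Defs
  imports Complex_Main "HOL-Library.FuncSet"
begin

text \<open>
  The set of sounds is the type \<^typ>\<open>'a\<close>. Throughout, \<open>L x y\<close> means that \<open>x\<close> is lower-pitched
  than \<open>y\<close>, and \<open>C i j\<close> means that the intervals \<open>i\<close> and \<open>j\<close> are congruent.
\<close>

definition same_pitch :: "('a \<Rightarrow> 'a \<Rightarrow> bool) \<Rightarrow> 'a \<Rightarrow> 'a \<Rightarrow> bool" where
  "same_pitch L x y \<longleftrightarrow> \<not> L x y \<and> \<not> L y x"

definition pitch_rel :: "('a \<Rightarrow> 'a \<Rightarrow> bool) \<Rightarrow> 'a rel" where
  "pitch_rel L = {(x, y). same_pitch L x y}"

definition pitch :: "('a \<Rightarrow> 'a \<Rightarrow> bool) \<Rightarrow> 'a \<Rightarrow> 'a set" where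
  "pitch L x = pitch_rel L `` {x}"

definition pitches :: "('a \<Rightarrow> 'a \<Rightarrow> bool) \<Rightarrow> 'a set set" where
  "pitches L = UNIV // pitch_rel L"

type_synonym 'a interval = "'a set \<times> 'a set"

definition ivl :: "('a \<Rightarrow> 'a \<Rightarrow> bool) \<Rightarrow> 'a \<Rightarrow> 'a \<Rightarrow> 'a interval" where
  "ivl L a b = (pitch L a, pitch L b)"

definition intervals :: "('a \<Rightarrow> 'a \<Rightarrow> bool) \<Rightarrow> 'a interval set" where
  "intervals L = pitches L \<times> pitches L"

definition inv_ivl :: "'a interval \<Rightarrow> 'a interval" where
  "inv_ivl i = (snd i, fst i)"

locale sound_system =
  fixes L :: "'a \<Rightarrow> 'a \<Rightarrow> bool"
    and C :: "'a interval \<Rightarrow> 'a interval \<Rightarrow> bool"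
  assumes lower_irrefl: "\<not> L x x"
    and lower_trans: "L x y \<Longrightarrow> L y z \<Longrightarrow> L x z"
    and lower_nontrivial: "\<exists>x y. L x y \<or> L y x"
    and lower_separates: "L x y \<Longrightarrow> \<not> (\<exists>z. same_pitch L x z \<and> same_pitch L y z)"
    and lower_unbounded: "\<exists>a b. L a x \<and> L x b"
    and lower_dense: "L x y \<Longrightarrow> \<exists>a. L x a \<and> L a y"
    and cong_on_intervals: "C i j \<Longrightarrow> i \<in> intervals L \<and> j \<in> intervals L"
    and cong_refl: "i \<in> intervals L \<Longrightarrow> C i i"
    and cong_trans: "C i j \<Longrightarrow> C j k \<Longrightarrow> C i k"
    and cong_transport:
      "\<exists>b. C (ivl L x y) (ivl L a b) \<and> (\<forall>b'. C (ivl L x y) (ivl L a b') \<longrightarrow> same_pitch L b b')"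
    and cong_direction: "L a b \<Longrightarrow> C (ivl L a b) (ivl L c d) \<Longrightarrow> L c d"
    and cong_inverse: "L a b \<Longrightarrow> C (ivl L a b) (ivl L c d) \<longleftrightarrow> C (ivl L b a) (ivl L d c)"
    and cong_add: "L a b \<Longrightarrow> L b c \<Longrightarrow>
      C (ivl L a b) (ivl L a' b') \<Longrightarrow> C (ivl L b c) (ivl L b' c') \<Longrightarrow> C (ivl L a c) (ivl L a' c')"
    and cong_add_inverse: "L a b \<Longrightarrow> L b c \<Longrightarrow>
      C (ivl L a b) (inv_ivl (ivl L a' b')) \<Longrightarrow> C (ivl L b c) (inv_ivl (ivl L b' c')) \<Longrightarrow>
      C (ivl L a c) (inv_ivl (ivl L a' c'))"
    and dedekind: "P \<union> Q = UNIV \<Longrightarrow> P \<inter> Q = {} \<Longrightarrow> P \<noteq> {} \<Longrightarrow> Q \<noteq> {} \<Longrightarrow>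
      (\<forall>p\<in>P. \<forall>q\<in>Q. \<not> L q p) \<Longrightarrow>
      \<exists>\<theta>. (\<forall>s. L s \<theta> \<longrightarrow> s \<in> P) \<and> (\<forall>s. L \<theta> s \<longrightarrow> s \<in> Q)"

definition unit_ivl :: "('a \<Rightarrow> 'a \<Rightarrow> bool) \<Rightarrow> 'a interval \<Rightarrow> bool" where
  "unit_ivl L i \<longleftrightarrow> (\<exists>a b. i = ivl L a b \<and> same_pitch L a b)"

definition gt_unit :: "('a \<Rightarrow> 'a \<Rightarrow> bool) \<Rightarrow> 'a interval \<Rightarrow> bool" where
  "gt_unit L i \<longleftrightarrow> (\<exists>a b. i = ivl L a b \<and> L a b)"

definition lt_unit :: "('a \<Rightarrow> 'a \<Rightarrow> bool) \<Rightarrow> 'a interval \<Rightarrow> bool" where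
  "lt_unit L i \<longleftrightarrow> (\<exists>a b. i = ivl L a b \<and> L b a)"

definition less_above_unit ::
  "('a \<Rightarrow> 'a \<Rightarrow> bool) \<Rightarrow> ('a interval \<Rightarrow> 'a interval \<Rightarrow> bool) \<Rightarrow> 'a interval \<Rightarrow> 'a interval \<Rightarrow> bool" where
  "less_above_unit L C i j \<longleftrightarrow> gt_unit L i \<and> gt_unit L j \<and>
     (\<exists>c d x. j = ivl L c d \<and> L x d \<and> C i (ivl L c x))"

definition less_ivl ::
  "('a \<Rightarrow> 'a \<Rightarrow> bool) \<Rightarrow> ('a interval \<Rightarrow> 'a interval \<Rightarrow> bool) \<Rightarrow> 'a interval \<Rightarrow> 'a interval \<Rightarrow> bool" where
  "less_ivl L C i j \<longleftrightarrow> less_above_unit L C i j \<or>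
     (lt_unit L i \<and> lt_unit L j \<and> less_above_unit L C (inv_ivl j) (inv_ivl i))"

definition free_ivl :: "('a interval \<Rightarrow> 'a interval \<Rightarrow> bool) \<Rightarrow> 'a interval \<Rightarrow> 'a interval set" where
  "free_ivl C i = {j. C i j}"

definition prec ::
  "('a \<Rightarrow> 'a \<Rightarrow> bool) \<Rightarrow> ('a interval \<Rightarrow> 'a interval \<Rightarrow> bool) \<Rightarrow>
   'a interval set \<Rightarrow> 'a interval set \<Rightarrow> bool" where
  "prec L C A B \<longleftrightarrow> (\<exists>i\<in>intervals L. \<exists>j\<in>intervals L. A = free_ivl C i \<and> B = free_ivl C j \<and>
     (gt_unit L j \<and> (lt_unit L i \<or> unit_ivl L i \<or> less_ivl L C i j) \<or>
      unit_ivl L j \<and> lt_unit L i \<or>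
      lt_unit L i \<and> lt_unit L j \<and> less_ivl L C i j))"

definition dyadics :: "real set" where
  "dyadics = {of_int n / 2 ^ k | (n :: int) (k :: nat). True}"

fun nat_mult ::
  "('a \<Rightarrow> 'a \<Rightarrow> bool) \<Rightarrow> ('a interval \<Rightarrow> 'a interval \<Rightarrow> bool) \<Rightarrow> nat \<Rightarrow> 'a interval \<Rightarrow> 'a interval" where
  "nat_mult L C 0 i = (fst i, fst i)"
| "nat_mult L C (Suc 0) i = i"
| "nat_mult L C (Suc (Suc n)) i =
     (fst i, THE q. q \<in> pitches L \<and> C (snd (nat_mult L C (Suc n) i), q) i)"

definition int_mult ::
  "('a \<Rightarrow> 'a \<Rightarrow> bool) \<Rightarrow> ('a interval \<Rightarrow> 'a interval \<Rightarrow> bool) \<Rightarrow> int \<Rightarrow> 'a interval \<Rightarrow> 'a interval" where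
  "int_mult L C n i =
     (if 0 \<le> n then nat_mult L C (nat n) i else nat_mult L C (nat (- n)) (inv_ivl i))"

definition half_mult ::
  "('a \<Rightarrow> 'a \<Rightarrow> bool) \<Rightarrow> ('a interval \<Rightarrow> 'a interval \<Rightarrow> bool) \<Rightarrow> 'a interval \<Rightarrow> 'a interval" where
  "half_mult L C i = (fst i, THE m. m \<in> pitches L \<and> C (fst i, m) (m, snd i))"

text \<open>
  The product of \<open>n / 2 ^ k\<close> with an interval takes \<open>n\<close> and \<open>k\<close> separately: for negative \<open>n\<close>,
  different representations of one dyadic number give intervals that are congruent but need
  not be equal. For instance \<open>-1 \<cdot> [a, b] = [b, a]\<close>, whereas \<open>-2 / 2 \<cdot> [a, b]\<close> starts at the
  midsound of \<open>[a, b]\<close>.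
\<close>

definition dyadic_mult ::
  "('a \<Rightarrow> 'a \<Rightarrow> bool) \<Rightarrow> ('a interval \<Rightarrow> 'a interval \<Rightarrow> bool) \<Rightarrow> int \<Rightarrow> nat \<Rightarrow>
   'a interval \<Rightarrow> 'a interval" where
  "dyadic_mult L C n k i = int_mult L C n ((half_mult L C ^^ k) i)"

end

theory Submission
  imports Defs "HOL-Algebra.Group"
begin

text \<open>
  Measured from a fixed pitch \<open>e\<close>, pitches can be added: \<open>p + q\<close> is the pitch at which the interval
  \<open>[e, q]\<close> ends once it has been moved, by congruence, so as to start at \<open>p\<close>. Associativity comes
  from the fact that congruence respects the juxtaposition of intervals, and commutativity from the
  crossed form of the addition axiom. The pitches thus form an abelian group with a
  translation-invariant linear order, and this order is dense and Dedekind complete.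

  By Hoelder's theorem such a group is a copy of the real line (\<open>width_bij\<close>). This gives every pitch a
  real height in such a way that the order of pitches is the order of heights, and two intervals are
  congruent exactly when their heights rise by the same amount (\<open>real_scale\<close>). In terms of the rise
  everything else becomes arithmetic: the order of free intervals is the order of the rises
  (\<open>prec_iff\<close>), and the product of a dyadic number with an interval multiplies the rise
  (\<open>dyadic_mult\<close>). If heights are normalised so that \<open>[x\<^sub>0, y\<^sub>0]\<close> rises by 1, the required ratio of an
  interval is \<open>\<lambda>\<close> to the power of its rise.

  The ratio is unique because the law for dyadic products forces the value \<open>\<lambda>\<close> to the power \<open>w\<close> on
  \<open>w \<cdot> [x\<^sub>0, y\<^sub>0]\<close>. These values are dense among the positive reals, so the position of any interval
  relative to the dyadic products of \<open>[x\<^sub>0, y\<^sub>0]\<close> determines its ratio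
  (\<open>eq_if_order_and_dyadics_agree\<close>).
\<close>

section \<open>Dedekind complete ordered abelian groups\<close>

locale linordered_comm_group = comm_group G for G (structure) +
  fixes less :: "'a \<Rightarrow> 'a \<Rightarrow> bool" (infix "\<prec>" 50)
  assumes less_irrefl: "x \<in> carrier G \<Longrightarrow> \<not> x \<prec> x"
    and less_trans: "x \<in> carrier G \<Longrightarrow> y \<in> carrier G \<Longrightarrow> z \<in> carrier G \<Longrightarrow> x \<prec> y \<Longrightarrow> y \<prec> z \<Longrightarrow> x \<prec> z"
    and less_linear: "x \<in> carrier G \<Longrightarrow> y \<in> carrier G \<Longrightarrow> x \<prec> y \<or> x = y \<or> y \<prec> x"
    and mult_less: "x \<in> carrier G \<Longrightarrow> y \<in> carrier G \<Longrightarrow> z \<in> carrier G \<Longrightarrow> x \<prec> y \<Longrightarrow> z \<otimes> x \<prec> z \<otimes> y"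
begin

definition le (infix "\<preceq>" 50) where "x \<preceq> y \<longleftrightarrow> x \<prec> y \<or> x = y"

lemma not_less_iff: "x \<in> carrier G \<Longrightarrow> y \<in> carrier G \<Longrightarrow> \<not> x \<prec> y \<longleftrightarrow> y \<preceq> x"
  using less_irrefl less_linear less_trans unfolding le_def by blast

lemma le_less_trans: "x \<in> carrier G \<Longrightarrow> y \<in> carrier G \<Longrightarrow> z \<in> carrier G \<Longrightarrow> x \<preceq> y \<Longrightarrow> y \<prec> z \<Longrightarrow> x \<prec> z"
  using less_trans unfolding le_def by blast

lemma le_trans: "x \<in> carrier G \<Longrightarrow> y \<in> carrier G \<Longrightarrow> z \<in> carrier G \<Longrightarrow> x \<preceq> y \<Longrightarrow> y \<preceq> z \<Longrightarrow> x \<preceq> z"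
  using less_trans unfolding le_def by blast

lemma mult_less_mono:
  assumes "a \<in> carrier G" "b \<in> carrier G" "c \<in> carrier G" "d \<in> carrier G" "a \<prec> b" "c \<prec> d"
  shows "a \<otimes> c \<prec> b \<otimes> d"
proof -
  have "c \<otimes> a \<prec> c \<otimes> b" "b \<otimes> c \<prec> b \<otimes> d"
    using assms by (auto intro: mult_less)
  then show ?thesis
    using assms less_trans[of "a \<otimes> c" "b \<otimes> c" "b \<otimes> d"] by (simp add: m_comm)
qed

lemma mult_le_mono:
  assumes "a \<in> carrier G" "b \<in> carrier G" "c \<in> carrier G" "d \<in> carrier G" "a \<preceq> b" "c \<preceq> d"
  shows "a \<otimes> c \<preceq> b \<otimes> d"
  using assms mult_less_mono[of a b c d] mult_less[of c d a] mult_less[of a b c]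
  by (auto simp: le_def m_comm)

lemma mult_less_cancel:
  assumes "x \<in> carrier G" "y \<in> carrier G" "z \<in> carrier G"
  shows "z \<otimes> x \<prec> z \<otimes> y \<longleftrightarrow> x \<prec> y"
  using assms mult_less[of x y z] mult_less[of y x z] less_linear[of x y]
    less_irrefl[of "z \<otimes> x"] less_trans[of "z \<otimes> x" "z \<otimes> y" "z \<otimes> x"]
  by auto

lemma one_less_iff:
  assumes "x \<in> carrier G" "y \<in> carrier G"
  shows "\<one> \<prec> inv x \<otimes> y \<longleftrightarrow> x \<prec> y"
  using mult_less_cancel[of \<one> "inv x \<otimes> y" x] assms by (simp add: m_assoc[symmetric])

lemma one_less_nat_pow:
  assumes "u \<in> carrier G" "\<one> \<prec> u" shows "\<one> \<prec> u [^] Suc n"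
proof (induction n)
  case 0
  then show ?case using assms by simp
next
  case (Suc n)
  have "\<one> \<otimes> \<one> \<prec> u [^] Suc n \<otimes> u"
    using Suc assms by (intro mult_less_mono) auto
  then show ?case by simp
qed

lemma int_pow_less:
  assumes "u \<in> carrier G" "\<one> \<prec> u" "m < (n::int)" shows "u [^] m \<prec> u [^] n"
proof -
  obtain k where k: "n = m + int (Suc k)"
    using assms(3) by (metis zless_iff_Suc_zadd)
  have "u [^] m \<otimes> \<one> \<prec> u [^] m \<otimes> u [^] Suc k"
    using assms one_less_nat_pow[OF assms(1,2)] by (intro mult_less) auto
  moreover have "u [^] n = u [^] m \<otimes> u [^] Suc k"
    unfolding k int_pow_mult[OF assms(1)] int_pow_int ..
  ultimately show ?thesis using assms by simp
qed

lemma int_pow_less_iff: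
  assumes "u \<in> carrier G" "\<one> \<prec> u" shows "u [^] m \<prec> u [^] (n::int) \<longleftrightarrow> m < n"
  using int_pow_less[OF assms, of m n] int_pow_less[OF assms, of n m] assms
    less_irrefl less_trans by (metis int_pow_closed linorder_neqE)

lemma int_pow_le_iff:
  assumes "u \<in> carrier G" "\<one> \<prec> u" shows "u [^] m \<preceq> u [^] (n::int) \<longleftrightarrow> m \<le> n"
  using int_pow_less_iff[OF assms, of n m] assms not_less_iff
  by (metis int_pow_closed linorder_not_less)

end

text \<open>
  The element \<open>u\<close> is the unit of measurement. The cut property is stated for the lower half \<open>D\<close> alone,
  and \<open>t\<close> may belong to either half, as it does in the cut axiom for sounds.
\<close>

locale dedekind_group = linordered_comm_group +
  fixes u
  assumes unit_closed [simp]: "u \<in> carrier G"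
    and unit_pos: "\<one> \<prec> u"
    and dense: "x \<in> carrier G \<Longrightarrow> y \<in> carrier G \<Longrightarrow> x \<prec> y \<Longrightarrow> \<exists>z\<in>carrier G. x \<prec> z \<and> z \<prec> y"
    and cut: "D \<subseteq> carrier G \<Longrightarrow> D \<noteq> {} \<Longrightarrow> D \<noteq> carrier G \<Longrightarrow>
      (\<And>x y. x \<in> D \<Longrightarrow> y \<in> carrier G \<Longrightarrow> y \<prec> x \<Longrightarrow> y \<in> D) \<Longrightarrow>
      \<exists>t\<in>carrier G. (\<forall>x\<in>carrier G. x \<prec> t \<longrightarrow> x \<in> D) \<and> (\<forall>x\<in>carrier G. t \<prec> x \<longrightarrow> x \<notin> D)"
begin

text \<open>
  If the powers of \<open>v\<close> were bounded, the elements below some power would have an upper end \<open>t\<close>. Then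
  \<open>inv v \<otimes> t\<close> is at most a power of \<open>v\<close>, hence so is \<open>t\<close>, and the power after that lies above \<open>t\<close>.
\<close>

lemma archimedean:
  assumes v: "v \<in> carrier G" "\<one> \<prec> v" and x: "x \<in> carrier G"
  shows "\<exists>n::nat. x \<preceq> v [^] n"
proof (rule ccontr)
  assume none: "\<nexists>n::nat. x \<preceq> v [^] n"
  define D where "D = {y \<in> carrier G. \<exists>n::nat. y \<preceq> v [^] n}"
  have "D \<subseteq> carrier G" by (auto simp: D_def)
  moreover have "\<one> \<in> D" by (auto simp: D_def le_def intro!: exI[of _ "0::nat"])
  then have "D \<noteq> {}" by blast
  moreover have "x \<notin> D" using none by (simp add: D_def)
  then have "D \<noteq> carrier G" using x by blast
  moreover have "z \<in> D" if "y \<in> D" "z \<in> carrier G" "z \<prec> y" for y z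
    using that le_trans[of z y] v by (auto simp: D_def le_def[of z y])
  ultimately obtain t where t: "t \<in> carrier G"
    and below: "\<And>y. y \<in> carrier G \<Longrightarrow> y \<prec> t \<Longrightarrow> y \<in> D"
    and above: "\<And>y. y \<in> carrier G \<Longrightarrow> t \<prec> y \<Longrightarrow> y \<notin> D"
    using cut[of D] by blast
  have "inv v \<prec> \<one>"
    using mult_less[of \<one> v "inv v"] v by simp
  then have "inv v \<otimes> t \<prec> t"
    using mult_less[of "inv v" \<one> t] v t by (simp add: m_comm[of t])
  then obtain n :: nat where n: "inv v \<otimes> t \<preceq> v [^] n"
    using below[of "inv v \<otimes> t"] v t unfolding D_def by blast
  have "v \<otimes> (inv v \<otimes> t) \<preceq> v \<otimes> v [^] n"
    using v t n by (intro mult_le_mono) (auto simp: le_def)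
  then have "t \<preceq> v [^] Suc n"
    using v t by (simp add: m_assoc[symmetric] m_comm[of v])
  moreover have "v [^] Suc n \<prec> v [^] Suc (Suc n)"
    using mult_less[of \<one> v "v [^] Suc n"] v by simp
  ultimately have "t \<prec> v [^] Suc (Suc n)"
    using le_less_trans v t nat_pow_closed by blast
  then show False
    using above[of "v [^] Suc (Suc n)"] v unfolding D_def le_def by blast
qed

text \<open>
  The integer part of \<open>x\<close> when \<open>u\<close> is the unit of measurement.
\<close>

definition level :: "'a \<Rightarrow> int" where
  "level x = (SOME n. u [^] n \<preceq> x \<and> x \<prec> u [^] (n + 1))"

lemma level:
  assumes x: "x \<in> carrier G"
  shows "u [^] level x \<preceq> x" "x \<prec> u [^] (level x + 1)"
proof -
  obtain b :: nat where b: "x \<preceq> u [^] b"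
    using archimedean[OF unit_closed unit_pos x] by blast
  obtain a :: nat where a: "inv x \<preceq> u [^] a"
    using archimedean[OF unit_closed unit_pos, of "inv x"] x by blast
  have "x \<otimes> inv u [^] a \<otimes> inv x \<preceq> x \<otimes> inv u [^] a \<otimes> u [^] a"
    using a x by (intro mult_le_mono) (auto simp: le_def)
  then have low: "u [^] (- int a) \<preceq> x"
    using x by (simp add: int_pow_neg_int m_assoc nat_pow_inv m_comm[of "inv (u [^] a)" "inv x"])
      (simp add: m_assoc[symmetric])
  have bound: "n \<le> int b" if "u [^] n \<preceq> x" for n :: int
    using le_trans[OF _ _ _ that b] x int_pow_le_iff[OF unit_closed unit_pos, of n "int b"]
    by (simp add: int_pow_int)
  \<comment> \<open>The level is the largest exponent in this finite set.\<close>
  define S where "S = {- int a..int b} \<inter> {n. u [^] n \<preceq> x}"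
  have "finite S" and S: "- int a \<in> S"
    using low bound by (auto simp: S_def)
  define n where "n = Max S"
  have "n \<in> S" and "- int a \<le> n" and max: "\<And>m. m \<in> S \<Longrightarrow> m \<le> n"
    using \<open>finite S\<close> S Max_in[of S] by (auto simp: n_def intro: Max_in)
  have "m \<le> n" if "u [^] m \<preceq> x" for m
    using that bound[OF that] max[of m] \<open>- int a \<le> n\<close> by (force simp: S_def)
  then have "\<not> u [^] (n + 1) \<preceq> x" by force
  with \<open>n \<in> S\<close> have "u [^] n \<preceq> x" "\<not> u [^] (n + 1) \<preceq> x"
    by (auto simp: S_def)
  then have "u [^] n \<preceq> x \<and> x \<prec> u [^] (n + 1)"
    using not_less_iff[of x "u [^] (n + 1)"] x by simp
  then have "u [^] level x \<preceq> x \<and> x \<prec> u [^] (level x + 1)"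
    unfolding level_def by (rule someI)
  then show "u [^] level x \<preceq> x" "x \<prec> u [^] (level x + 1)" by auto
qed

lemma le_levelI:
  assumes "x \<in> carrier G" "u [^] n \<preceq> x" shows "n \<le> level x"
  using le_less_trans[OF _ _ _ assms(2) level(2)] assms(1)
    int_pow_less_iff[OF unit_closed unit_pos, of n "level x + 1"] by simp

lemma level_leI:
  assumes "x \<in> carrier G" "x \<prec> u [^] (n + 1)" shows "level x \<le> n"
  using le_less_trans[OF _ _ _ level(1) assms(2)] assms(1)
    int_pow_less_iff[OF unit_closed unit_pos, of "level x" "n + 1"] by simp

text \<open>
  Rounding down is additive up to an error of at most one. Applied to powers of \<open>x\<close> and divided by the
  exponent, the error disappears in the limit, and this makes the width additive.
\<close>

lemma level_mult:
  assumes "x \<in> carrier G" "y \<in> carrier G"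
  shows "level x + level y \<le> level (x \<otimes> y)" "level (x \<otimes> y) \<le> level x + level y + 1"
proof -
  have "u [^] (level x + level y) \<preceq> x \<otimes> y"
    using assms level(1) by (auto simp: int_pow_mult intro!: mult_le_mono)
  then show "level x + level y \<le> level (x \<otimes> y)"
    using assms by (intro le_levelI) auto
  have "x \<otimes> y \<prec> u [^] (level x + 1) \<otimes> u [^] (level y + 1)"
    using assms level(2) by (intro mult_less_mono) auto
  also have "u [^] (level x + 1) \<otimes> u [^] (level y + 1) = u [^] (level x + level y + 1 + 1)"
    by (simp add: int_pow_mult[symmetric] algebra_simps)
  finally show "level (x \<otimes> y) \<le> level x + level y + 1"
    using assms by (intro level_leI) auto
qed

text \<open>
  Instead of dividing the unit, \<open>x\<close> is multiplied: \<open>x\<close> to the power \<open>2 ^ k\<close> is measured in whole units, and the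
  result is scaled back. This avoids midpoints, whose existence only follows from \<open>width_bij\<close>.
\<close>

definition approx :: "'a \<Rightarrow> nat \<Rightarrow> real" where
  "approx x k = level (x [^] (2 ^ k :: nat)) / 2 ^ k"

definition width :: "'a \<Rightarrow> real" where
  "width x = lim (approx x)"

text \<open>
  The measurements increase, while the upper bounds that go with them, larger by \<open>1 / 2 ^ k\<close>, decrease.
\<close>

lemma approx_Suc:
  assumes "x \<in> carrier G"
  shows "approx x k \<le> approx x (Suc k)" "approx x (Suc k) + 1 / 2 ^ Suc k \<le> approx x k + 1 / 2 ^ k"
proof -
  let ?y = "x [^] (2 ^ k :: nat)"
  have "x [^] (2 ^ Suc k :: nat) = ?y \<otimes> ?y"
    using assms by (simp add: nat_pow_mult mult_2)
  then have "2 * level ?y \<le> level (x [^] (2 ^ Suc k :: nat))"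
     "level (x [^] (2 ^ Suc k :: nat)) \<le> 2 * level ?y + 1"
    using level_mult[of ?y ?y] assms by auto
  then have "2 * real_of_int (level ?y) \<le> level (x [^] (2 ^ Suc k :: nat))"
     "level (x [^] (2 ^ Suc k :: nat)) + 1 \<le> 2 * real_of_int (level ?y) + 2" by linarith+
  then have "2 * real_of_int (level ?y) / 2 ^ Suc k \<le> level (x [^] (2 ^ Suc k :: nat)) / 2 ^ Suc k"
     "(level (x [^] (2 ^ Suc k :: nat)) + 1) / 2 ^ Suc k \<le> (2 * real_of_int (level ?y) + 2) / 2 ^ Suc k"
    by (auto intro!: divide_right_mono simp del: power_Suc)
  then show "approx x k \<le> approx x (Suc k)"
    "approx x (Suc k) + 1 / 2 ^ Suc k \<le> approx x k + 1 / 2 ^ k"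
    unfolding approx_def by (simp_all add: add_divide_distrib)
qed

lemma
  assumes "x \<in> carrier G"
  shows approx_tendsto: "approx x \<longlonglongrightarrow> width x" and approx_le_width: "approx x k \<le> width x"
proof -
  have inc: "incseq (approx x)" using approx_Suc(1)[OF assms] by (rule incseq_SucI)
  have "decseq (\<lambda>k. approx x k + 1 / 2 ^ k)" using approx_Suc(2)[OF assms] by (rule decseq_SucI)
  then have "approx x k + 1 / 2 ^ k \<le> approx x 0 + 1 / 2 ^ 0" for k
    by (rule decseqD) simp
  then have "approx x k \<le> approx x 0 + 1" for k
    by (smt (verit) divide_nonneg_nonneg zero_le_power div_by_1 power_0)
  then obtain l where "approx x \<longlonglongrightarrow> l"
    using incseq_convergent[OF inc] by blast
  then show lim: "approx x \<longlonglongrightarrow> width x" by (simp add: width_def limI)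
  show "approx x k \<le> width x" using incseq_le[OF inc lim] .
qed

lemma width_mult:
  assumes x: "x \<in> carrier G" and y: "y \<in> carrier G"
  shows "width (x \<otimes> y) = width x + width y"
proof -
  have "\<bar>approx (x \<otimes> y) k - (approx x k + approx y k)\<bar> \<le> (1/2) ^ k" for k
  proof -
    have "(x \<otimes> y) [^] (2 ^ k :: nat) = x [^] (2 ^ k :: nat) \<otimes> y [^] (2 ^ k :: nat)"
      using x y by (simp add: pow_mult_distrib m_comm)
    then have "0 \<le> level ((x \<otimes> y) [^] (2 ^ k :: nat)) - level (x [^] (2 ^ k :: nat)) - level (y [^] (2 ^ k :: nat))"
      "level ((x \<otimes> y) [^] (2 ^ k :: nat)) - level (x [^] (2 ^ k :: nat)) - level (y [^] (2 ^ k :: nat)) \<le> 1"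
      using level_mult[of "x [^] (2 ^ k :: nat)" "y [^] (2 ^ k :: nat)"] x y by auto
    then have "\<bar>real_of_int (level ((x \<otimes> y) [^] (2 ^ k :: nat))) - level (x [^] (2 ^ k :: nat)) - level (y [^] (2 ^ k :: nat))\<bar> \<le> 1"
      by linarith
    then show ?thesis
      unfolding approx_def
      by (simp add: add_divide_distrib[symmetric] diff_divide_distrib[symmetric] power_divide field_simps abs_divide)
  qed
  moreover have lim: "(\<lambda>k. (1/2) ^ k :: real) \<longlonglongrightarrow> 0" by (rule LIMSEQ_power_zero) simp
  ultimately have "(\<lambda>k. approx (x \<otimes> y) k - (approx x k + approx y k)) \<longlonglongrightarrow> 0"
    by (intro tendsto_0_le[OF lim, where K = 1]) (auto simp: eventually_sequentially)
  moreover have "(\<lambda>k. approx (x \<otimes> y) k - (approx x k + approx y k)) \<longlonglongrightarrow> width (x \<otimes> y) - (width x + width y)"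
    using x y by (intro tendsto_intros approx_tendsto) auto
  ultimately show ?thesis using LIMSEQ_unique by fastforce
qed

text \<open>
  Some power of \<open>x\<close> reaches the unit, so one of the increasing measurements of \<open>x\<close> is already positive.
\<close>

lemma width_pos:
  assumes x: "x \<in> carrier G" "\<one> \<prec> x" shows "0 < width x"
proof -
  obtain n :: nat where n: "u \<preceq> x [^] n" using archimedean[OF x unit_closed] by blast
  have "x [^] int n \<preceq> x [^] int (2 ^ n)"
    unfolding int_pow_le_iff[OF x] by (simp add: less_imp_le)
  then have "u \<preceq> x [^] (2 ^ n :: nat)"
    using le_trans[OF _ _ _ n, of "x [^] (2 ^ n :: nat)"] x unfolding int_pow_int by simp
  then have "1 \<le> level (x [^] (2 ^ n :: nat))"
    using x by (intro le_levelI) (simp_all add: int_pow_1)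
  then have "0 < approx x n" by (simp add: approx_def)
  also have "\<dots> \<le> width x" using x by (simp add: approx_le_width)
  finally show ?thesis .
qed

lemma width_one: "width \<one> = 0"
  using width_mult[of \<one> \<one>] by simp

lemma width_unit: "width u = 1"
proof -
  have "level (u [^] n) = int n" for n :: nat
  proof (rule antisym)
    show "level (u [^] n) \<le> int n"
      using int_pow_less[OF unit_closed unit_pos, of "int n" "int n + 1"]
      by (intro level_leI) (simp_all add: int_pow_int)
    show "int n \<le> level (u [^] n)"
      by (intro le_levelI) (simp_all add: int_pow_int le_def)
  qed
  then have "approx u = (\<lambda>k. 1)" by (simp add: approx_def fun_eq_iff)
  then show ?thesis by (simp add: width_def)
qed

lemma width_diff:
  assumes "x \<in> carrier G" "y \<in> carrier G"
  shows "width (inv x \<otimes> y) = width y - width x"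
  using width_mult[of x "inv x \<otimes> y"] assms by (simp add: m_assoc[symmetric])

lemma width_less_iff:
  assumes "x \<in> carrier G" "y \<in> carrier G"
  shows "width x < width y \<longleftrightarrow> x \<prec> y"
proof -
  have *: "width x < width y" if "x \<in> carrier G" "y \<in> carrier G" "x \<prec> y" for x y
    using width_pos[of "inv x \<otimes> y"] width_diff[of x y] one_less_iff[of x y] that by simp
  then show ?thesis using assms less_linear[of x y] by (metis order_less_asym)
qed

lemma width_eq_iff:
  assumes "x \<in> carrier G" "y \<in> carrier G"
  shows "width x = width y \<longleftrightarrow> x = y"
  using assms width_less_iff less_linear by (metis order_less_irrefl)

text \<open>
  An element strictly between \<open>\<one>\<close> and \<open>x\<close> splits \<open>x\<close> into two positive factors, one of which has at most
  half the width of \<open>x\<close>.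
\<close>

lemma small_elements: "\<exists>x\<in>carrier G. \<one> \<prec> x \<and> width x \<le> 1 / 2 ^ k"
proof (induction k)
  case 0
  then show ?case using unit_pos width_unit by force
next
  case (Suc k)
  then obtain x where x: "x \<in> carrier G" "\<one> \<prec> x" "width x \<le> 1 / 2 ^ k" by blast
  then obtain z where z: "z \<in> carrier G" "\<one> \<prec> z" "z \<prec> x"
    using dense[of \<one> x] by auto
  have "\<one> \<prec> inv z \<otimes> x" using one_less_iff z x by simp
  moreover have "width z + width (inv z \<otimes> x) = width x" using width_diff z x by simp
  then have "2 * width z \<le> 1 / 2 ^ k \<or> 2 * width (inv z \<otimes> x) \<le> 1 / 2 ^ k"
    using x(3) by linarith
  then have "width z \<le> 1 / 2 ^ Suc k \<or> width (inv z \<otimes> x) \<le> 1 / 2 ^ Suc k"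
    by (simp add: divide_divide_eq_left[symmetric] mult.commute[of 2] del: divide_divide_eq_left)
  ultimately show ?case using z x m_closed inv_closed by blast
qed

lemma width_int_pow:
  assumes "x \<in> carrier G" shows "width (x [^] (n::int)) = n * width x"
proof -
  have nat: "width (x [^] m) = m * width x" for m :: nat
    using assms by (induction m) (auto simp: width_one width_mult algebra_simps)
  show ?thesis
  proof (cases n rule: int_cases2)
    case (nonneg m)
    then show ?thesis by (simp add: int_pow_int nat)
  next
    case (nonpos m)
    have "width (inv (x [^] m)) = - width (x [^] m)"
      using width_diff[of "x [^] m" \<one>] assms by (simp add: width_one)
    then show ?thesis using nonpos assms by (simp add: int_pow_neg_int nat)
  qed
qed

text \<open>
  Powers of an element whose width is less than \<open>s - r\<close> cannot jump over the gap between \<open>r\<close> and \<open>s\<close>.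
\<close>

lemma width_dense:
  assumes "r < s" shows "\<exists>x\<in>carrier G. r < width x \<and> width x < s"
proof -
  obtain k :: nat where k: "1 / 2 ^ k < s - r"
    using real_arch_pow_inv[of "s - r" "1/2"] assms by (auto simp: power_divide)
  obtain x where x: "x \<in> carrier G" "\<one> \<prec> x" "width x \<le> 1 / 2 ^ k"
    using small_elements by blast
  have pos: "0 < width x" using width_pos x by simp
  define n where "n = \<lfloor>r / width x\<rfloor> + 1"
  have "r / width x < n" "n - 1 \<le> r / width x" unfolding n_def by linarith+
  then have "r < n * width x" "n * width x \<le> r + width x"
    using pos by (simp_all add: field_simps)
  then show ?thesis
    using x k by (intro bexI[of _ "x [^] n"]) (auto simp: width_int_pow)
qed

text \<open>
  The cut of the group at the real number \<open>r\<close> is filled by some \<open>t\<close>. As widths are dense, a width of \<open>t\<close>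
  different from \<open>r\<close> would leave room for an element on the wrong side of the cut.
\<close>

theorem width_bij: "bij_betw width (carrier G) UNIV"
proof -
  have "\<exists>t\<in>carrier G. width t = r" for r
  proof -
    define D where "D = {x \<in> carrier G. width x \<le> r}"
    obtain a where "a \<in> carrier G" "width a < r"
      using width_dense[of "r - 1" r] by auto
    moreover obtain b where "b \<in> carrier G" "r < width b"
      using width_dense[of r "r + 1"] by auto
    ultimately have "a \<in> D" "b \<notin> D" by (auto simp: D_def)
    then have "D \<subseteq> carrier G" "D \<noteq> {}" "D \<noteq> carrier G"
      using \<open>b \<in> carrier G\<close> by (auto simp: D_def)
    moreover have "y \<in> D" if "x \<in> D" "y \<in> carrier G" "y \<prec> x" for x y
      using that width_less_iff[of y x] by (simp add: D_def)
    ultimately obtain t where t: "t \<in> carrier G"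
      and below: "\<And>x. x \<in> carrier G \<Longrightarrow> x \<prec> t \<Longrightarrow> x \<in> D"
      and above: "\<And>x. x \<in> carrier G \<Longrightarrow> t \<prec> x \<Longrightarrow> x \<notin> D"
      using cut[of D] by blast
    have "\<not> width t < r"
    proof
      assume "width t < r"
      then obtain x where "x \<in> carrier G" "width t < width x" "width x < r"
        using width_dense by blast
      then show False using above[of x] t by (simp add: D_def width_less_iff)
    qed
    moreover have "\<not> r < width t"
    proof
      assume "r < width t"
      then obtain x where "x \<in> carrier G" "r < width x" "width x < width t"
        using width_dense by blast
      then show False using below[of x] t by (simp add: D_def width_less_iff)
    qed
    ultimately show ?thesis using t by force
  qed
  then have "width ` carrier G = UNIV" by (metis UNIV_eq_I imageI)
  then show ?thesis by (simp add: bij_betw_def inj_on_def width_eq_iff)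
qed

end

section \<open>Pitches as an ordered set\<close>

context sound_system
begin

lemma same_pitch_refl: "same_pitch L x x"
  by (simp add: same_pitch_def lower_irrefl)

lemma same_pitch_trans: "same_pitch L x y \<Longrightarrow> same_pitch L y z \<Longrightarrow> same_pitch L x z"
  using lower_separates[of x z] lower_separates[of z x] unfolding same_pitch_def by blast

lemma pitch_eq_iff: "pitch L x = pitch L y \<longleftrightarrow> same_pitch L x y"
  using same_pitch_refl same_pitch_trans
  unfolding pitch_def pitch_rel_def same_pitch_def by blast

lemma pitch_in_pitches [simp]: "pitch L x \<in> pitches L"
  by (auto simp: pitch_def pitches_def intro: quotientI)

lemma pitches_cases:
  assumes "p \<in> pitches L" obtains x where "p = pitch L x"
  using assms by (auto simp: pitch_def pitches_def elim: quotientE)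

lemma lower_cong:
  assumes "same_pitch L x x'" "same_pitch L y y'" "L x y" shows "L x' y'"
  using assms lower_trans same_pitch_trans lower_separates unfolding same_pitch_def by metis

lemma gt_unit_ivl [simp]: "gt_unit L (ivl L x y) \<longleftrightarrow> L x y"
proof
  assume "gt_unit L (ivl L x y)"
  then obtain a b where "pitch L a = pitch L x" "pitch L b = pitch L y" "L a b"
    unfolding gt_unit_def ivl_def by auto
  then show "L x y" using lower_cong pitch_eq_iff by blast
qed (auto simp: gt_unit_def)

lemma lt_unit_iff: "lt_unit L i \<longleftrightarrow> gt_unit L (inv_ivl i)"
  by (cases i) (auto simp: lt_unit_def gt_unit_def inv_ivl_def ivl_def)

lemma unit_ivl_iff: "i \<in> intervals L \<Longrightarrow> unit_ivl L i \<longleftrightarrow> fst i = snd i"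
  unfolding unit_ivl_def intervals_def ivl_def pitch_eq_iff[symmetric]
  by (auto elim!: pitches_cases) blast

abbreviation below (infix "\<prec>" 50) where "p \<prec> q \<equiv> gt_unit L (p, q)"

lemma pitch_below [simp]: "pitch L x \<prec> pitch L y \<longleftrightarrow> L x y"
  using gt_unit_ivl unfolding ivl_def .

text \<open>
  Representatives make it possible to restate the axioms, given for sounds, as laws about pitches, where
  the relation of having the same pitch becomes equality.
\<close>

definition sound_at :: "'a set \<Rightarrow> 'a" where
  "sound_at p = (SOME x. p = pitch L x)"

lemma pitch_sound_at [simp]: "p \<in> pitches L \<Longrightarrow> pitch L (sound_at p) = p"
  unfolding sound_at_def by (metis (mono_tags, lifting) pitches_cases someI_ex)

lemma ivl_sound_at [simp]:
  "p \<in> pitches L \<Longrightarrow> q \<in> pitches L \<Longrightarrow> ivl L (sound_at p) (sound_at q) = (p, q)"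
  by (simp add: ivl_def)

lemma lower_sound_at [simp]:
  "p \<in> pitches L \<Longrightarrow> q \<in> pitches L \<Longrightarrow> L (sound_at p) (sound_at q) \<longleftrightarrow> p \<prec> q"
  using gt_unit_ivl[of "sound_at p" "sound_at q"] by simp

lemma below_irrefl: "p \<in> pitches L \<Longrightarrow> \<not> p \<prec> p"
  by (auto elim!: pitches_cases simp: lower_irrefl)

lemma below_trans:
  "p \<in> pitches L \<Longrightarrow> q \<in> pitches L \<Longrightarrow> r \<in> pitches L \<Longrightarrow> p \<prec> q \<Longrightarrow> q \<prec> r \<Longrightarrow> p \<prec> r"
  by (auto elim!: pitches_cases intro: lower_trans)

lemma below_linear: "p \<in> pitches L \<Longrightarrow> q \<in> pitches L \<Longrightarrow> p \<prec> q \<or> p = q \<or> q \<prec> p"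
  using pitch_eq_iff[of "sound_at p" "sound_at q"] by (auto simp: same_pitch_def)

lemma below_dense:
  assumes "p \<in> pitches L" "q \<in> pitches L" "p \<prec> q" shows "\<exists>r\<in>pitches L. p \<prec> r \<and> r \<prec> q"
proof -
  obtain x where "L (sound_at p) x" "L x (sound_at q)"
    using lower_dense[of "sound_at p" "sound_at q"] assms by auto
  then have "pitch L (sound_at p) \<prec> pitch L x" "pitch L x \<prec> pitch L (sound_at q)" by simp_all
  then show ?thesis using assms by (intro bexI[of _ "pitch L x"]) simp_all
qed

lemma below_cut:
  assumes D: "D \<subseteq> pitches L" "D \<noteq> {}" "D \<noteq> pitches L"
    and down: "\<And>p q. p \<in> D \<Longrightarrow> q \<in> pitches L \<Longrightarrow> q \<prec> p \<Longrightarrow> q \<in> D"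
  shows "\<exists>t\<in>pitches L. (\<forall>p\<in>pitches L. p \<prec> t \<longrightarrow> p \<in> D) \<and> (\<forall>p\<in>pitches L. t \<prec> p \<longrightarrow> p \<notin> D)"
proof -
  define P where "P = {x. pitch L x \<in> D}"
  obtain p q where "p \<in> D" "q \<in> pitches L" "q \<notin> D" using D by blast
  then have "P \<noteq> {}" "- P \<noteq> {}"
    using D(1) pitch_sound_at[of p] pitch_sound_at[of q] unfolding P_def
    by (metis (mono_tags) Compl_iff empty_iff mem_Collect_eq subsetD)+
  moreover have "\<not> L y x" if "x \<in> P" "y \<in> - P" for x y
    using that down[of "pitch L x" "pitch L y"] by (auto simp: P_def)
  ultimately obtain t where "\<forall>x. L x t \<longrightarrow> x \<in> P" "\<forall>x. L t x \<longrightarrow> x \<in> - P"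
    using dedekind[of P "- P"] by blast
  then show ?thesis
    by (intro bexI[of _ "pitch L t"]) (auto simp: P_def elim!: pitches_cases)
qed

section \<open>Congruence and the addition of pitches\<close>

lemma cong_pitches:
  "C (p, q) (p', q') \<Longrightarrow> p \<in> pitches L \<and> q \<in> pitches L \<and> p' \<in> pitches L \<and> q' \<in> pitches L"
  using cong_on_intervals[of "(p, q)" "(p', q')"] by (auto simp: intervals_def)

lemma transport_ex:
  assumes "p \<in> pitches L" "q \<in> pitches L" "p' \<in> pitches L"
  shows "\<exists>q'\<in>pitches L. C (p, q) (p', q')"
proof -
  obtain b where "C (ivl L (sound_at p) (sound_at q)) (ivl L (sound_at p') b)"
    using cong_transport by blast
  then have "C (p, q) (p', pitch L b)" using assms by (simp add: ivl_def)
  then show ?thesis by (intro bexI[of _ "pitch L b"]) simp_all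
qed

lemma transport_unique:
  assumes "C (p, q) (p', r)" "C (p, q) (p', s)"
  shows "r = s"
proof -
  obtain b where b:
    "\<And>b'. C (ivl L (sound_at p) (sound_at q)) (ivl L (sound_at p') b') \<Longrightarrow> same_pitch L b b'"
    using cong_transport[of "sound_at p" "sound_at q" "sound_at p'"] by blast
  note in_pitches = cong_pitches[OF assms(1)] cong_pitches[OF assms(2)]
  have "pitch L b = r" "pitch L b = s"
    using b[of "sound_at r"] b[of "sound_at s"] assms in_pitches by (auto simp: pitch_eq_iff[symmetric])
  then show ?thesis by simp
qed

text \<open>
  Moving the second interval back to \<open>p\<close> yields an interval congruent to the first one and with the same
  start, which by uniqueness of transport is the first one.
\<close>

lemma cong_sym:
  assumes "C (p, q) (p', q')" shows "C (p', q') (p, q)"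
proof -
  note in_pitches = cong_pitches[OF assms]
  obtain r where r: "C (p', q') (p, r)" using transport_ex in_pitches by blast
  have "C (p, q) (p, q)" using in_pitches by (intro cong_refl) (simp add: intervals_def)
  then have "r = q" using transport_unique cong_trans[OF assms r] by blast
  then show ?thesis using r by simp
qed

lemma cong_below:
  assumes "C (p, q) (p', q')" "p \<prec> q" shows "p' \<prec> q'"
  using assms cong_direction[of "sound_at p" "sound_at q" "sound_at p'" "sound_at q'"]
    cong_pitches[OF assms(1)] by simp

lemma cong_swap_above:
  assumes "p \<in> pitches L" "q \<in> pitches L" "p' \<in> pitches L" "q' \<in> pitches L" "p \<prec> q"
  shows "C (p, q) (p', q') \<longleftrightarrow> C (q, p) (q', p')"
  using assms cong_inverse[of "sound_at p" "sound_at q" "sound_at p'" "sound_at q'"] by simp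

lemma cong_unit:
  assumes "p \<in> pitches L" "p' \<in> pitches L"
  shows "C (p, p) (p', q) \<longleftrightarrow> q = p'"
proof -
  have "q = p'" if "C (p, p) (p', q)" for q
  proof -
    have q: "q \<in> pitches L" using cong_pitches[OF that] by blast
    moreover have "\<not> p' \<prec> q" using cong_below[OF cong_sym[OF that]] below_irrefl assms by blast
    moreover have "\<not> q \<prec> p'"
      using cong_swap_above[of q p' p p] cong_sym[OF that] cong_below[of q p' p p]
        below_irrefl assms q by blast
    ultimately show ?thesis using below_linear assms by blast
  qed
  then show ?thesis using transport_ex[of p p p'] assms by auto
qed

lemma cong_swap:
  assumes "C (p, q) (p', q')" shows "C (q, p) (q', p')"
proof -
  note in_pitches = cong_pitches[OF assms]
  consider "p \<prec> q" | "p = q" | "q \<prec> p" using below_linear in_pitches by blast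
  then show ?thesis
  proof cases
    case 2
    then show ?thesis using assms in_pitches by (simp add: cong_unit)
  qed (use cong_swap_above in_pitches assms in blast)+
qed

lemma cong_add_above:
  assumes "C (p, q) (p', q')" "C (q, r) (q', r')" "p \<prec> q" "q \<prec> r"
  shows "C (p, r) (p', r')"
  using assms cong_add[of "sound_at p" "sound_at q" "sound_at r" "sound_at p'" "sound_at q'" "sound_at r'"]
    cong_pitches[OF assms(1)] cong_pitches[OF assms(2)] by simp

lemma cong_add_crossed:
  assumes "C (p, q) (q', p')" "C (q, r) (r', q')" "p \<prec> q" "q \<prec> r"
  shows "C (p, r) (r', p')"
  using assms cong_add_inverse[of "sound_at p" "sound_at q" "sound_at r" "sound_at p'" "sound_at q'" "sound_at r'"]
    cong_pitches[OF assms(1)] cong_pitches[OF assms(2)] by (simp add: inv_ivl_def)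

text \<open>
  Subtraction follows from addition: when the two parts are moved to \<open>p'\<close> one after the other, they
  end at \<open>r'\<close>, and uniqueness of transport identifies the pitch in between.
\<close>

lemma cong_cancel_upper:
  assumes "C (p, r) (p', r')" "C (q, r) (q', r')" "p \<prec> q" "q \<prec> r"
  shows "C (p, q) (p', q')"
proof -
  note in_pitches = cong_pitches[OF assms(1)] cong_pitches[OF assms(2)]
  obtain s where s: "s \<in> pitches L" "C (p, q) (p', s)" using transport_ex in_pitches by blast
  obtain t where t: "t \<in> pitches L" "C (q, r) (s, t)" using transport_ex in_pitches s by blast
  have "t = r'" using cong_add_above[OF s(2) t(2) assms(3,4)] transport_unique assms(1) by blast
  then have "C (r, q) (r', s)" using cong_swap t by blast
  then have "s = q'" using transport_unique cong_swap[OF assms(2)] by blast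
  then show ?thesis using s by simp
qed

lemma cong_cancel_lower:
  assumes "C (p, r) (p', r')" "C (p, q) (p', q')" "p \<prec> q" "q \<prec> r"
  shows "C (q, r) (q', r')"
proof -
  note in_pitches = cong_pitches[OF assms(1)] cong_pitches[OF assms(2)]
  obtain t where t: "t \<in> pitches L" "C (q, r) (q', t)" using transport_ex in_pitches by blast
  have "t = r'" using cong_add_above[OF assms(2) t(2) assms(3,4)] transport_unique assms(1) by blast
  then show ?thesis using t by simp
qed

text \<open>
  Juxtaposition of intervals in arbitrary directions. The order of \<open>p\<close>, \<open>q\<close> and \<open>r\<close> decides which of the
  three intervals is the sum of the other two; in each case the claim is an instance of
  addition or cancellation for ascending intervals, up to reversal.
\<close>

lemma cong_chain:
  assumes pq: "C (p, q) (p', q')" and qr: "C (q, r) (q', r')"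
  shows "C (p, r) (p', r')"
proof -
  note in_pitches = cong_pitches[OF pq] cong_pitches[OF qr]
  note reversed = cong_swap[OF qr] cong_swap[OF pq]
  consider "p = q" | "q = r" | "p = r"
    | "p \<prec> q" "q \<prec> r" | "r \<prec> q" "q \<prec> p" | "p \<prec> r" "r \<prec> q" | "r \<prec> p" "p \<prec> q"
    | "q \<prec> p" "p \<prec> r" | "q \<prec> r" "r \<prec> p"
    using below_linear in_pitches by metis
  then show ?thesis
  proof cases
    case 1
    then show ?thesis using assms in_pitches by (simp add: cong_unit)
  next
    case 2
    then show ?thesis using assms in_pitches by (simp add: cong_unit)
  next
    case 3
    then show ?thesis using transport_unique[OF reversed(2)] qr in_pitches by (simp add: cong_unit)
  next
    case 4
    then show ?thesis using cong_add_above pq qr by blast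
  next
    case 5
    then show ?thesis using cong_add_above reversed cong_swap by blast
  next
    case 6
    then show ?thesis using cong_cancel_upper[OF pq reversed(1)] by blast
  next
    case 7
    then show ?thesis using cong_cancel_upper[OF reversed(1) pq] cong_swap by blast
  next
    case 8
    then show ?thesis using cong_cancel_lower[OF qr reversed(2)] by blast
  next
    case 9
    then show ?thesis using cong_cancel_lower[OF reversed(2) qr] cong_swap by blast
  qed
qed

text \<open>
  Addition of pitches with origin \<open>e\<close>.
\<close>

definition translate :: "'a set \<Rightarrow> 'a set \<Rightarrow> 'a set \<Rightarrow> 'a set" where
  "translate e p q = (THE r. C (e, q) (p, r))"

definition pitch_group :: "'a set \<Rightarrow> 'a set monoid" where
  "pitch_group e = \<lparr>carrier = pitches L, mult = translate e, one = e\<rparr>"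

lemma translate_cong:
  assumes "e \<in> pitches L" "p \<in> pitches L" "q \<in> pitches L"
  shows "C (e, q) (p, translate e p q)"
proof -
  obtain r where r: "C (e, q) (p, r)" using transport_ex assms by blast
  show ?thesis
    unfolding translate_def using r transport_unique[OF _ r] by (rule theI)
qed

lemma translate_eq_iff:
  assumes "e \<in> pitches L" "p \<in> pitches L" "q \<in> pitches L"
  shows "translate e p q = r \<longleftrightarrow> C (e, q) (p, r)"
  using translate_cong[OF assms] transport_unique[OF translate_cong[OF assms], of r] by auto

lemma translate_closed:
  assumes "e \<in> pitches L" "p \<in> pitches L" "q \<in> pitches L"
  shows "translate e p q \<in> pitches L"
  using translate_cong[OF assms] cong_pitches by blast

text \<open>
  The interval \<open>[e, p + q]\<close> is composed of \<open>[e, p]\<close> followed by a copy of \<open>[e, q]\<close>. The crossed addition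
  axiom allows the two parts to be placed in the opposite order, which gives \<open>[e, q + p]\<close>.
\<close>

lemma translate_commute_above:
  assumes "e \<in> pitches L" "p \<in> pitches L" "q \<in> pitches L" "e \<prec> p" "e \<prec> q"
  shows "translate e p q = translate e q p"
proof -
  have pq: "C (e, q) (p, translate e p q)" and qp: "C (e, p) (q, translate e q p)"
    using assms by (simp_all add: translate_cong)
  have "p \<prec> translate e p q" using cong_below[OF pq] assms by blast
  then have "C (e, translate e p q) (e, translate e q p)"
    using cong_add_crossed[OF qp cong_sym[OF pq]] assms by blast
  moreover have "C (e, translate e p q) (e, translate e p q)"
    using assms by (intro cong_refl) (simp add: intervals_def translate_closed)
  ultimately show ?thesis using transport_unique by blast
qed

lemma group_pitch_group:
  assumes e: "e \<in> pitches L"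
  shows "group (pitch_group e)"
proof (rule groupI; unfold pitch_group_def, simp_all)
  show "translate e p q \<in> pitches L" if "p \<in> pitches L" "q \<in> pitches L" for p q
    using that e by (simp add: translate_closed)
  show "e \<in> pitches L" by fact
  show "translate e e p = p" if "p \<in> pitches L" for p
    using that e by (simp add: translate_eq_iff cong_refl intervals_def)
  show "\<exists>q\<in>pitches L. translate e q p = e" if p: "p \<in> pitches L" for p
  proof -
    obtain q where "q \<in> pitches L" "C (p, e) (e, q)" using transport_ex e p by blast
    then show ?thesis using cong_swap e p by (auto simp: translate_eq_iff intro!: bexI[of _ q])
  qed
  show "translate e (translate e p q) r = translate e p (translate e q r)"
    if "p \<in> pitches L" "q \<in> pitches L" "r \<in> pitches L" for p q r
  proof -
    let ?pq = "translate e p q" and ?qr = "translate e q r"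
    have closed: "?pq \<in> pitches L" "?qr \<in> pitches L" using that e by (simp_all add: translate_closed)
    have "C (q, ?qr) (?pq, translate e ?pq r)"
      using cong_trans cong_sym translate_cong closed that e by meson
    then have "C (e, ?qr) (p, translate e ?pq r)"
      using cong_chain translate_cong that e by meson
    then show ?thesis using closed that e translate_eq_iff by metis
  qed
qed

text \<open>
  Elements below \<open>e\<close> have inverses above \<open>e\<close>, and two elements of a group commute if one commutes with the
  inverse of the other.
\<close>

lemma translate_commute:
  assumes e: "e \<in> pitches L" and "p \<in> pitches L" "q \<in> pitches L"
  shows "translate e p q = translate e q p"
proof -
  interpret group "pitch_group e" using group_pitch_group[OF e] .
  have carr: "carrier (pitch_group e) = pitches L" and one: "\<one>\<^bsub>pitch_group e\<^esub> = e"
    and mult: "x \<otimes>\<^bsub>pitch_group e\<^esub> y = translate e x y" for x y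
    by (simp_all add: pitch_group_def)
  define comm where "comm x y \<longleftrightarrow> x \<otimes>\<^bsub>pitch_group e\<^esub> y = y \<otimes>\<^bsub>pitch_group e\<^esub> x" for x y
  have comm_inv: "comm x y" if "comm (inv\<^bsub>pitch_group e\<^esub> x) y" "x \<in> pitches L" "y \<in> pitches L" for x y
    using that unfolding comm_def carr[symmetric]
    by (metis inv_closed inv_solve_left inv_solve_right m_assoc m_closed)
  have inv_above: "e \<prec> inv\<^bsub>pitch_group e\<^esub> x" if x: "x \<in> pitches L" "x \<prec> e" for x
  proof -
    have "translate e (inv\<^bsub>pitch_group e\<^esub> x) x = e" using x carr one mult l_inv by metis
    then have "C (x, e) (e, inv\<^bsub>pitch_group e\<^esub> x)"
      using translate_cong[of e "inv\<^bsub>pitch_group e\<^esub> x" x] x e carr inv_closed cong_swap by metis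
    then show ?thesis using cong_below x by blast
  qed
  have *: "comm x y" if x: "e \<prec> x" "x \<in> pitches L" and y: "y \<in> pitches L" for x y
  proof -
    consider "e \<prec> y" | "y = e" | "y \<prec> e" using below_linear e y by blast
    then show ?thesis
    proof cases
      case 1
      then show ?thesis using translate_commute_above e x y by (simp add: comm_def mult)
    next
      case 2
      then show ?thesis using x y carr one by (metis comm_def l_one r_one)
    next
      case 3
      then have "comm x (inv\<^bsub>pitch_group e\<^esub> y)"
        using translate_commute_above e x y inv_above[of y] carr inv_closed
        by (metis comm_def mult)
      then show ?thesis using comm_inv x y by (metis comm_def)
    qed
  qed
  consider "e \<prec> p" | "p = e" | "p \<prec> e" using below_linear assms by blast
  then have "comm p q"
  proof cases
    case 1
    then show ?thesis using * assms by blast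
  next
    case 2
    then show ?thesis using assms carr one by (metis comm_def l_one r_one)
  next
    case 3
    then show ?thesis using comm_inv *[of "inv\<^bsub>pitch_group e\<^esub> p" q] inv_above assms carr inv_closed by metis
  qed
  then show ?thesis by (simp add: comm_def mult)
qed

lemma dedekind_pitch_group:
  assumes e: "e \<in> pitches L" and u: "u \<in> pitches L" "e \<prec> u"
  shows "dedekind_group (pitch_group e) below u"
proof -
  interpret comm_group "pitch_group e"
    using group.group_comm_groupI[OF group_pitch_group[OF e]] translate_commute[OF e]
    by (simp add: pitch_group_def)
  have carr: "carrier (pitch_group e) = pitches L" and one: "\<one>\<^bsub>pitch_group e\<^esub> = e"
    and mult: "x \<otimes>\<^bsub>pitch_group e\<^esub> y = translate e x y" for x y
    by (simp_all add: pitch_group_def)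
  show ?thesis
  proof (unfold_locales, unfold carr one mult)
    fix p q r assume in_pitches: "p \<in> pitches L" "q \<in> pitches L" "r \<in> pitches L" and "p \<prec> q"
    have "C (p, q) (translate e r p, translate e r q)"
      using cong_chain cong_swap translate_cong e in_pitches by meson
    then show "translate e r p \<prec> translate e r q" using cong_below \<open>p \<prec> q\<close> by blast
  next
    fix D assume D: "D \<subseteq> pitches L" "D \<noteq> {}" "D \<noteq> pitches L"
      "\<And>p q. p \<in> D \<Longrightarrow> q \<in> pitches L \<Longrightarrow> q \<prec> p \<Longrightarrow> q \<in> D"
    show "\<exists>t\<in>pitches L. (\<forall>p\<in>pitches L. p \<prec> t \<longrightarrow> p \<in> D) \<and> (\<forall>p\<in>pitches L. t \<prec> p \<longrightarrow> p \<notin> D)"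
      by (rule below_cut[OF D])
  qed (fact below_irrefl below_trans below_linear below_dense u)+
qed

text \<open>
  The interval \<open>[p, q]\<close> is congruent to \<open>[e, x]\<close> for the pitch \<open>x\<close> with \<open>p + x = q\<close>. So congruence of two
  intervals means that the same \<open>x\<close> leads from start to end in both, and the width is additive.
\<close>

theorem real_scale:
  assumes u: "e \<in> pitches L" "u \<in> pitches L" "e \<prec> u"
  obtains h :: "'a set \<Rightarrow> real" where
    "bij_betw h (pitches L) UNIV"
    "h u - h e = 1"
    "\<And>p q. p \<in> pitches L \<Longrightarrow> q \<in> pitches L \<Longrightarrow> p \<prec> q \<longleftrightarrow> h p < h q"
    "\<And>p q p' q'. p \<in> pitches L \<Longrightarrow> q \<in> pitches L \<Longrightarrow> p' \<in> pitches L \<Longrightarrow> q' \<in> pitches L \<Longrightarrow>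
      C (p, q) (p', q') \<longleftrightarrow> h q - h p = h q' - h p'"
proof -
  interpret dedekind_group "pitch_group e" below u using dedekind_pitch_group assms by blast
  have carr: "carrier (pitch_group e) = pitches L" and one: "\<one>\<^bsub>pitch_group e\<^esub> = e"
    and mult: "x \<otimes>\<^bsub>pitch_group e\<^esub> y = translate e x y" for x y
    by (simp_all add: pitch_group_def)
  show thesis
  proof (rule that)
    show "bij_betw width (pitches L) UNIV" using width_bij carr by simp
    show "width u - width e = 1" using width_unit width_one one by simp
    show "p \<prec> q \<longleftrightarrow> width p < width q" if "p \<in> pitches L" "q \<in> pitches L" for p q
      using width_less_iff that carr by simp
    fix p q p' q' assume in_pitches: "p \<in> pitches L" "q \<in> pitches L" "p' \<in> pitches L" "q' \<in> pitches L"
    obtain x where x: "x \<in> pitches L" "C (p, q) (e, x)" using transport_ex in_pitches u by blast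
    have "translate e p x = q" using cong_sym[OF x(2)] x in_pitches u by (simp add: translate_eq_iff)
    then have q: "width q = width p + width x" using width_mult[of p x] in_pitches x carr mult by simp
    have "C (p, q) (p', q') \<longleftrightarrow> C (e, x) (p', q')"
      using x(2) cong_sym[OF x(2)] cong_trans by blast
    also have "\<dots> \<longleftrightarrow> translate e p' x = q'" using x in_pitches u by (simp add: translate_eq_iff)
    also have "\<dots> \<longleftrightarrow> width (translate e p' x) = width q'"
      using width_eq_iff[of "translate e p' x" q'] in_pitches x u carr translate_closed by simp
    also have "\<dots> \<longleftrightarrow> width p' + width x = width q'"
      using width_mult[of p' x] in_pitches x carr mult by simp
    finally show "C (p, q) (p', q') \<longleftrightarrow> width q - width p = width q' - width p'" using q by auto
  qed
qed

end

section \<open>Intervals measured by their rise\<close>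

locale scaled_sound_system = sound_system +
  fixes h :: "'a set \<Rightarrow> real"
  assumes height_bij: "bij_betw h (pitches L) UNIV"
    and below_iff: "p \<in> pitches L \<Longrightarrow> q \<in> pitches L \<Longrightarrow> gt_unit L (p, q) \<longleftrightarrow> h p < h q"
    and cong_pair_iff: "p \<in> pitches L \<Longrightarrow> q \<in> pitches L \<Longrightarrow> p' \<in> pitches L \<Longrightarrow> q' \<in> pitches L \<Longrightarrow>
      C (p, q) (p', q') \<longleftrightarrow> h q - h p = h q' - h p'"
begin

definition rise :: "'a interval \<Rightarrow> real" where
  "rise i = h (snd i) - h (fst i)"

lemma interval_iff: "i \<in> intervals L \<longleftrightarrow> fst i \<in> pitches L \<and> snd i \<in> pitches L"
  by (cases i) (simp add: intervals_def)

lemma ivl_interval [simp]: "ivl L a b \<in> intervals L"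
  by (simp add: interval_iff ivl_def)

lemma height_eq_iff: "p \<in> pitches L \<Longrightarrow> q \<in> pitches L \<Longrightarrow> h p = h q \<longleftrightarrow> p = q"
  using height_bij by (auto simp: bij_betw_def inj_on_def)

text \<open>
  The inverse of the height. All definite descriptions in the definitions of multiples and
  midsounds have values of this form.
\<close>

definition pitch_at :: "real \<Rightarrow> 'a set" where
  "pitch_at r = inv_into (pitches L) h r"

lemma pitch_at: "pitch_at r \<in> pitches L" "h (pitch_at r) = r"
proof -
  have "r \<in> h ` pitches L" using height_bij by (simp add: bij_betw_def)
  then show "pitch_at r \<in> pitches L" "h (pitch_at r) = r"
    unfolding pitch_at_def by (rule inv_into_into, rule f_inv_into_f)
qed

lemma the_pitch:
  assumes "\<And>q. q \<in> pitches L \<Longrightarrow> \<Phi> q \<longleftrightarrow> h q = r"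
  shows "(THE q. q \<in> pitches L \<and> \<Phi> q) = pitch_at r"
proof (rule the_equality)
  show "pitch_at r \<in> pitches L \<and> \<Phi> (pitch_at r)" using assms pitch_at by blast
  show "q = pitch_at r" if "q \<in> pitches L \<and> \<Phi> q" for q
    using that assms pitch_at height_eq_iff by metis
qed

lemma cong_iff:
  assumes "i \<in> intervals L" "j \<in> intervals L" shows "C i j \<longleftrightarrow> rise i = rise j"
  using assms cong_pair_iff[of "fst i" "snd i" "fst j" "snd j"] by (simp add: interval_iff rise_def)

lemma gt_unit_iff:
  assumes "i \<in> intervals L" shows "gt_unit L i \<longleftrightarrow> 0 < rise i"
  using assms below_iff[of "fst i" "snd i"] by (simp add: interval_iff rise_def)

lemma inv_ivl_interval [simp]: "inv_ivl i \<in> intervals L \<longleftrightarrow> i \<in> intervals L"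
  by (auto simp: interval_iff inv_ivl_def)

lemma rise_inv_ivl [simp]: "rise (inv_ivl i) = - rise i"
  by (simp add: inv_ivl_def rise_def)

lemma lt_unit_iff_rise:
  assumes "i \<in> intervals L" shows "lt_unit L i \<longleftrightarrow> rise i < 0"
  using assms gt_unit_iff[of "inv_ivl i"] by (simp add: lt_unit_iff)

lemma unit_ivl_iff_rise:
  assumes "i \<in> intervals L" shows "unit_ivl L i \<longleftrightarrow> rise i = 0"
  using assms height_eq_iff[of "snd i" "fst i"] by (auto simp: unit_ivl_iff interval_iff rise_def)

lemma less_above_unit_iff:
  assumes i: "i \<in> intervals L" and j: "j \<in> intervals L"
  shows "less_above_unit L C i j \<longleftrightarrow> 0 < rise i \<and> rise i < rise j"
proof
  assume less: "less_above_unit L C i j"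
  then obtain c d x where *: "j = ivl L c d" "L x d" "C i (ivl L c x)"
    unfolding less_above_unit_def by blast
  have "rise i = rise (ivl L c x)" using * i by (simp add: cong_iff)
  moreover have "h (pitch L x) < h (pitch L d)" using * below_iff[of "pitch L x" "pitch L d"] by simp
  ultimately show "0 < rise i \<and> rise i < rise j"
    using less gt_unit_iff[OF i] * by (simp add: less_above_unit_def rise_def ivl_def)
next
  assume rise: "0 < rise i \<and> rise i < rise j"
  define x where "x = pitch_at (h (fst j) + rise i)"
  have x: "x \<in> pitches L" "h x = h (fst j) + rise i" by (simp_all add: x_def pitch_at)
  have "L (sound_at x) (sound_at (snd j))"
    using j x rise by (simp add: interval_iff below_iff) (simp add: rise_def)
  moreover have "j = ivl L (sound_at (fst j)) (sound_at (snd j))"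
    using j by (simp add: interval_iff)
  moreover have "C i (ivl L (sound_at (fst j)) (sound_at x))"
    using cong_iff[OF i, of "(fst j, x)"] j x by (simp add: interval_iff rise_def)
  ultimately show "less_above_unit L C i j"
    unfolding less_above_unit_def using gt_unit_iff i j rise by (metis less_trans)
qed

lemma less_ivl_iff:
  assumes "i \<in> intervals L" "j \<in> intervals L"
  shows "less_ivl L C i j \<longleftrightarrow> rise i < rise j \<and> (0 < rise i \<or> rise j < 0)"
  using assms by (auto simp: less_ivl_def less_above_unit_iff lt_unit_iff_rise)

lemma free_ivl_eq_iff:
  assumes "i \<in> intervals L" "j \<in> intervals L"
  shows "free_ivl C i = free_ivl C j \<longleftrightarrow> rise i = rise j"
proof
  assume "free_ivl C i = free_ivl C j"
  moreover have "j \<in> free_ivl C j" using cong_refl assms by (simp add: free_ivl_def)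
  ultimately have "C i j" by (auto simp: free_ivl_def)
  then show "rise i = rise j" using cong_iff assms by simp
next
  assume "rise i = rise j"
  then have "C i k \<longleftrightarrow> C j k" for k
    using cong_on_intervals cong_iff assms by metis
  then show "free_ivl C i = free_ivl C j" by (simp add: free_ivl_def)
qed

text \<open>
  The order of free intervals speaks of arbitrary representatives, but all conditions in it depend on the
  rise only, which is the same for all representatives. The three alternatives then cover exactly
  the ways in which one real number can be less than another, relative to \<open>0\<close>.
\<close>

lemma prec_iff:
  assumes i: "i \<in> intervals L" and j: "j \<in> intervals L"
  shows "prec L C (free_ivl C i) (free_ivl C j) \<longleftrightarrow> rise i < rise j"
proof -
  have "prec L C (free_ivl C i) (free_ivl C j) \<longleftrightarrow>
    (\<exists>i'\<in>intervals L. \<exists>j'\<in>intervals L. rise i = rise i' \<and> rise j = rise j' \<and>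
      (0 < rise j' \<and> (rise i' < 0 \<or> rise i' = 0 \<or> rise i' < rise j' \<and> (0 < rise i' \<or> rise j' < 0)) \<or>
       rise j' = 0 \<and> rise i' < 0 \<or>
       rise i' < 0 \<and> rise j' < 0 \<and> rise i' < rise j' \<and> (0 < rise i' \<or> rise j' < 0)))"
    unfolding prec_def
    using i j by (intro bex_cong refl)
      (simp add: free_ivl_eq_iff gt_unit_iff lt_unit_iff_rise unit_ivl_iff_rise less_ivl_iff)
  also have "\<dots> \<longleftrightarrow> (\<exists>i'\<in>intervals L. \<exists>j'\<in>intervals L.
      rise i = rise i' \<and> rise j = rise j' \<and> rise i' < rise j')"
    by (intro bex_cong refl) linarith
  also have "\<dots> \<longleftrightarrow> rise i < rise j" using i j by auto
  finally show ?thesis .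
qed

lemma nat_mult:
  assumes i: "i \<in> intervals L"
  shows "nat_mult L C n i \<in> intervals L \<and> fst (nat_mult L C n i) = fst i \<and>
    rise (nat_mult L C n i) = n * rise i"
proof (induction n rule: induct_nat_012)
  case (ge2 n)
  let ?j = "nat_mult L C (Suc n) i"
  have j: "?j \<in> intervals L" "fst ?j = fst i" "rise ?j = Suc n * rise i" using ge2 by auto
  have "C (snd ?j, q) i \<longleftrightarrow> h q = h (snd ?j) + rise i" if "q \<in> pitches L" for q
    using that i j cong_iff[of "(snd ?j, q)" i] by (auto simp: interval_iff rise_def)
  then have "(THE q. q \<in> pitches L \<and> C (snd ?j, q) i) = pitch_at (h (snd ?j) + rise i)"
    by (rule the_pitch)
  then have "nat_mult L C (Suc (Suc n)) i = (fst i, pitch_at (h (snd ?j) + rise i))" by simp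
  moreover have "h (snd ?j) = h (fst i) + Suc n * rise i" using j by (simp add: rise_def)
  ultimately show ?case using i by (simp add: interval_iff pitch_at) (simp add: rise_def pitch_at algebra_simps)
qed (use i in \<open>auto simp: interval_iff rise_def\<close>)

lemma int_mult:
  assumes "i \<in> intervals L"
  shows "int_mult L C n i \<in> intervals L \<and> rise (int_mult L C n i) = n * rise i"
  using assms nat_mult[of i] nat_mult[of "inv_ivl i"] by (auto simp: int_mult_def)

lemma half_mult:
  assumes i: "i \<in> intervals L"
  shows "half_mult L C i \<in> intervals L \<and> rise (half_mult L C i) = rise i / 2"
proof -
  have "C (fst i, m) (m, snd i) \<longleftrightarrow> h m = (h (fst i) + h (snd i)) / 2" if "m \<in> pitches L" for m
    using that i cong_pair_iff[of "fst i" m m "snd i"] by (auto simp: interval_iff)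
  then have "(THE m. m \<in> pitches L \<and> C (fst i, m) (m, snd i)) = pitch_at ((h (fst i) + h (snd i)) / 2)"
    by (rule the_pitch)
  then show ?thesis using i by (simp add: half_mult_def interval_iff rise_def pitch_at field_simps)
qed

lemma dyadic_mult:
  assumes i: "i \<in> intervals L"
  shows "dyadic_mult L C n k i \<in> intervals L" "rise (dyadic_mult L C n k i) = n / 2 ^ k * rise i"
proof -
  have "(half_mult L C ^^ k) i \<in> intervals L \<and> rise ((half_mult L C ^^ k) i) = rise i / 2 ^ k"
  proof (induction k)
    case (Suc k)
    then show ?case using half_mult[of "(half_mult L C ^^ k) i"] by simp
  qed (use i in simp)
  then show "dyadic_mult L C n k i \<in> intervals L" "rise (dyadic_mult L C n k i) = n / 2 ^ k * rise i"
    using int_mult by (auto simp: dyadic_mult_def)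
qed

lemma rise_surj: "\<exists>i\<in>intervals L. rise i = r"
  by (intro bexI[of _ "(pitch_at 0, pitch_at r)"]) (simp_all add: rise_def interval_iff pitch_at)

end


section \<open>Existence and uniqueness of the ratio\<close>

lemma dyadic_between:
  fixes r s :: real
  assumes "r < s" shows "\<exists>(n::int) (k::nat). r < n / 2 ^ k \<and> n / 2 ^ k < s"
proof -
  obtain k :: nat where "1 / (s - r) < 2 ^ k" using real_arch_pow[of 2] by auto
  then have k: "1 < s * 2 ^ k - r * 2 ^ k" using assms by (simp add: field_simps)
  define n where "n = \<lfloor>r * 2 ^ k\<rfloor> + 1"
  have "r * 2 ^ k < n" "n < s * 2 ^ k" using k unfolding n_def by linarith+
  then have "r < n / 2 ^ k \<and> n / 2 ^ k < s" by (simp add: field_simps)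
  then show ?thesis by blast
qed

text \<open>
  If the values at \<open>x\<close> differed, some dyadic power of \<open>lam\<close> would lie strictly between them. It is a common
  value of \<open>f\<close> and \<open>g\<close> at some point of \<open>S\<close>, and this point would be above \<open>x\<close> for one function but not for the other.
\<close>

lemma eq_if_order_and_dyadics_agree:
  fixes f g :: "'b \<Rightarrow> real" and lam :: real
  assumes lam: "lam > 1" and pos: "f x > 0" "g x > 0"
    and order: "\<And>y. y \<in> S \<Longrightarrow> f x < f y \<longleftrightarrow> g x < g y"
    and dyadics: "\<And>(n::int) (k::nat). \<exists>y\<in>S. f y = lam powr (n / 2 ^ k) \<and> g y = lam powr (n / 2 ^ k)"
  shows "f x = g x"
proof -
  have sep: "\<exists>(n::int) (k::nat). a < lam powr (n / 2 ^ k) \<and> lam powr (n / 2 ^ k) < b"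
    if ab: "0 < a" "a < b" for a b
  proof -
    have "log lam a < log lam b" using lam ab by simp
    then obtain n :: int and k :: nat where "log lam a < n / 2 ^ k" "n / 2 ^ k < log lam b"
      using dyadic_between by blast
    then show ?thesis using lam ab by (auto simp: log_less_iff less_log_iff)
  qed
  have "\<not> f x < g x" "\<not> g x < f x"
    using sep[of "f x" "g x"] sep[of "g x" "f x"] pos order dyadics by (metis less_asym)+
  then show ?thesis by simp
qed

theorem theorem3p83:
  fixes L :: "'a \<Rightarrow> 'a \<Rightarrow> bool"
    and C :: "'a interval \<Rightarrow> 'a interval \<Rightarrow> bool"
    and x0 y0 :: 'a
    and lam :: real
  assumes "sound_system L C"
    and "gt_unit L (ivl L x0 y0)"
    and "lam > 1"
  shows "\<exists>!f :: 'a interval \<Rightarrow> real. f \<in> extensional (intervals L) \<and>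
    ((\<forall>i\<in>intervals L. f i > 0) \<and> f (ivl L x0 y0) = lam) \<and>
    (\<forall>a b. (f (ivl L a b) < 1 \<longleftrightarrow> L b a) \<and>
           (f (ivl L a b) = 1 \<longleftrightarrow> same_pitch L a b) \<and>
           (f (ivl L a b) > 1 \<longleftrightarrow> L a b)) \<and>
    (\<forall>i\<in>intervals L. \<forall>j\<in>intervals L. f i = f j \<longleftrightarrow> C i j) \<and>
    (\<forall>i\<in>intervals L. \<forall>j\<in>intervals L. f i < f j \<longleftrightarrow> prec L C (free_ivl C i) (free_ivl C j)) \<and>
    (\<forall>a b c. f (ivl L a c) = f (ivl L a b) * f (ivl L b c)) \<and>
    (\<forall>w\<in>dyadics. \<forall>(n :: int) (k :: nat). w = of_int n / 2 ^ k \<longrightarrow>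
       (\<forall>i\<in>intervals L. f (dyadic_mult L C n k i) = f i powr w)) \<and>
    (\<forall>r>0. \<exists>i\<in>intervals L. f i = r \<and> (\<forall>j\<in>intervals L. f j = r \<longrightarrow> C j i))"
proof -
  interpret sound_system L C by fact
  have "gt_unit L (pitch L x0, pitch L y0)" using assms(2) by (simp add: ivl_def)
  then obtain h where h: "h (pitch L y0) - h (pitch L x0) = 1" and "scaled_sound_system L C h"
    using real_scale[of "pitch L x0" "pitch L y0"] sound_system_axioms
    unfolding scaled_sound_system_def scaled_sound_system_axioms_def
    by (metis pitch_in_pitches)
  then interpret scaled_sound_system L C h by blast
  define f where "f = (\<lambda>i\<in>intervals L. lam powr rise i)"
  have f: "f i = lam powr rise i" if "i \<in> intervals L" for i using that by (simp add: f_def)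
  have rise_x0y0: "rise (ivl L x0 y0) = 1" using h by (simp add: rise_def ivl_def)
  have lower_iff: "L a b \<longleftrightarrow> 0 < rise (ivl L a b)" for a b
    using gt_unit_iff[of "ivl L a b"] by simp
  have rise_swap: "rise (ivl L b a) = - rise (ivl L a b)" for a b
    by (simp add: rise_def ivl_def)
  have powr_less_1: "lam powr r < 1 \<longleftrightarrow> r < 0" and powr_gt_1: "1 < lam powr r \<longleftrightarrow> 0 < r" for r
    using powr_less_cancel_iff[of lam r 0] powr_less_cancel_iff[of lam 0 r] assms(3) by simp_all
  show ?thesis
  proof (rule ex1I[of _ f]; (elim conjE)?)
    show "f \<in> extensional (intervals L) \<and>
      ((\<forall>i\<in>intervals L. f i > 0) \<and> f (ivl L x0 y0) = lam) \<and>
      (\<forall>a b. (f (ivl L a b) < 1 \<longleftrightarrow> L b a) \<and>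
             (f (ivl L a b) = 1 \<longleftrightarrow> same_pitch L a b) \<and>
             (f (ivl L a b) > 1 \<longleftrightarrow> L a b)) \<and>
      (\<forall>i\<in>intervals L. \<forall>j\<in>intervals L. f i = f j \<longleftrightarrow> C i j) \<and>
      (\<forall>i\<in>intervals L. \<forall>j\<in>intervals L. f i < f j \<longleftrightarrow> prec L C (free_ivl C i) (free_ivl C j)) \<and>
      (\<forall>a b c. f (ivl L a c) = f (ivl L a b) * f (ivl L b c)) \<and>
      (\<forall>w\<in>dyadics. \<forall>(n :: int) (k :: nat). w = of_int n / 2 ^ k \<longrightarrow>
         (\<forall>i\<in>intervals L. f (dyadic_mult L C n k i) = f i powr w)) \<and>
      (\<forall>r>0. \<exists>i\<in>intervals L. f i = r \<and> (\<forall>j\<in>intervals L. f j = r \<longrightarrow> C j i))"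
    proof (intro conjI allI ballI impI)
      show "f \<in> extensional (intervals L)" by (simp add: f_def)
      show "f i > 0" if "i \<in> intervals L" for i using that assms(3) by (simp add: f)
      show "f (ivl L x0 y0) = lam" using rise_x0y0 assms(3) by (simp add: f)
      show "f (ivl L a b) < 1 \<longleftrightarrow> L b a" for a b
        by (simp add: f lower_iff rise_swap[of a b] powr_less_1)
      show "f (ivl L a b) > 1 \<longleftrightarrow> L a b" for a b
        by (simp add: f lower_iff powr_gt_1)
      show "f (ivl L a b) = 1 \<longleftrightarrow> same_pitch L a b" for a b
        using powr_less_1[of "rise (ivl L a b)"] powr_gt_1[of "rise (ivl L a b)"] assms(3)
        by (auto simp: f same_pitch_def lower_iff rise_swap[of a b])
      show "f i = f j \<longleftrightarrow> C i j" if "i \<in> intervals L" "j \<in> intervals L" for i j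
        using that assms(3) by (simp add: f cong_iff powr_inj)
      show "f i < f j \<longleftrightarrow> prec L C (free_ivl C i) (free_ivl C j)"
        if "i \<in> intervals L" "j \<in> intervals L" for i j
        using that assms(3) by (simp add: f prec_iff)
      show "f (ivl L a c) = f (ivl L a b) * f (ivl L b c)" for a b c
        by (simp add: f powr_add[symmetric]) (simp add: rise_def ivl_def)
      show "f (dyadic_mult L C n k i) = f i powr w"
        if "w = of_int n / 2 ^ k" "i \<in> intervals L" for w and n :: int and k :: nat and i
        using that by (simp add: f dyadic_mult powr_powr mult.commute)
      show "\<exists>i\<in>intervals L. f i = r \<and> (\<forall>j\<in>intervals L. f j = r \<longrightarrow> C j i)" if "r > 0" for r
      proof -
        obtain i where i: "i \<in> intervals L" "rise i = log lam r" using rise_surj by blast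
        then have "f i = r" using that assms(3) by (simp add: f)
        moreover have "C j i" if "j \<in> intervals L" "f j = f i" for j
          using that i assms(3) by (simp add: f cong_iff powr_inj)
        ultimately show ?thesis using i by blast
      qed
    qed
  next
    fix g :: "'a interval \<Rightarrow> real"
    assume ext: "g \<in> extensional (intervals L)"
      and pos: "\<forall>i\<in>intervals L. g i > 0" and g0: "g (ivl L x0 y0) = lam"
      and order: "\<forall>i\<in>intervals L. \<forall>j\<in>intervals L. g i < g j \<longleftrightarrow> prec L C (free_ivl C i) (free_ivl C j)"
      and dyadic: "\<forall>w\<in>dyadics. \<forall>(n :: int) (k :: nat). w = of_int n / 2 ^ k \<longrightarrow>
        (\<forall>i\<in>intervals L. g (dyadic_mult L C n k i) = g i powr w)"
    show "g = f"
    proof (rule extensionalityI[OF ext])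
      show "f \<in> extensional (intervals L)" by (simp add: f_def)
      fix i assume i: "i \<in> intervals L"
      show "g i = f i"
      proof (rule eq_if_order_and_dyadics_agree[OF assms(3), where S = "intervals L"])
        show "g i > 0" "f i > 0" using pos i assms(3) by (simp_all add: f)
        show "g i < g j \<longleftrightarrow> f i < f j" if "j \<in> intervals L" for j
          using order i that assms(3) by (simp add: f prec_iff)
        fix n :: int and k :: nat
        let ?j = "dyadic_mult L C n k (ivl L x0 y0)"
        have "real_of_int n / 2 ^ k \<in> dyadics" by (auto simp: dyadics_def)
        then have "g ?j = lam powr (n / 2 ^ k)" using dyadic g0 by simp
        moreover have "f ?j = lam powr (n / 2 ^ k)" using rise_x0y0 by (simp add: f dyadic_mult)
        ultimately show "\<exists>j\<in>intervals L. g j = lam powr (n / 2 ^ k) \<and> f j = lam powr (n / 2 ^ k)"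
          by (intro bexI[of _ ?j]) (simp_all add: dyadic_mult)
      qed
    qed
  qed
qed

end
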